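(* Let $1\leq p,q<\infty$. Then $\ell^p(\ell^q)$ has maximal roundness $\min(p,p',q,q')$, i.e. $\mathrm{mr}(\ell^p(\ell^q))=\min(p,p',q,q')$.
   Context: All Banach spaces are real. $\ell^p(\ell^q)$ is the space of sequences $(x_n)_{n\ge1}$ of elements of the real sequence space $\ell^q$ with $\|(x_n)\|=\left(\sum_n\|x_n\|_{\ell^q}^p\right)^{1/p}<\infty$. $p'$ is the conjugate index, $\frac1p+\frac1{p'}=1$, with the convention $p'=\infty$ if $p=1$ (similarly for $q'$). A metric space $(X,d)$ has roundness $p\geq 1$ if for all $a_1,a_2,b_1,b_2\in X$, $d(a_1,a_2)^p+d(b_1,b_2)^p\leq\sum_{1\leq i,j\leq 2}d(a_i,b_j)^p$. For a Banach space $X$ this is equivalent (Enflo) to $\|x+y\|^p+\|x-y\|^p\leq 2(\|x\|^p+\|y\|^p)$ for all $x,y\in X$. The maximal roundness of a Banach space $X$ is $\mathrm{mr}(X)=\sup\{p\geq 1: X\text{ has roundness }p\}$. *)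

theory Defs
  imports "HOL-Analysis.Analysis"
begin

context Metric_space
begin

definition has_roundness :: "real \<Rightarrow> bool" where
  "has_roundness p \<longleftrightarrow> 1 \<le> p \<and>
     (\<forall>a1\<in>M. \<forall>a2\<in>M. \<forall>b1\<in>M. \<forall>b2\<in>M.
        d a1 a2 powr p + d b1 b2 powr p
          \<le> d a1 b1 powr p + d a1 b2 powr p + d a2 b1 powr p + d a2 b2 powr p)"

(* The supremum is taken in ereal because it is infinite for some metric spaces. *)
definition max_roundness :: ereal where
  "max_roundness = Sup (ereal ` {p. has_roundness p})"

end

(* The l^p-sum of countably many copies of a space with underlying set S and norm N. *)
definition lp_space :: "real \<Rightarrow> 'a set \<Rightarrow> ('a \<Rightarrow> real) \<Rightarrow> (nat \<Rightarrow> 'a) set" where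
  "lp_space p S N = {x. (\<forall>n. x n \<in> S) \<and> summable (\<lambda>n. N (x n) powr p)}"

definition lp_norm :: "real \<Rightarrow> ('a \<Rightarrow> real) \<Rightarrow> (nat \<Rightarrow> 'a) \<Rightarrow> real" where
  "lp_norm p N x = (\<Sum>n. N (x n) powr p) powr (1 / p)"

definition seq_space :: "real \<Rightarrow> (nat \<Rightarrow> real) set" where
  "seq_space q = lp_space q UNIV abs"

definition seq_norm :: "real \<Rightarrow> (nat \<Rightarrow> real) \<Rightarrow> real" where
  "seq_norm q = lp_norm q abs"

definition mixed_space :: "real \<Rightarrow> real \<Rightarrow> (nat \<Rightarrow> nat \<Rightarrow> real) set" where
  "mixed_space p q = lp_space p (seq_space q) (seq_norm q)"

definition mixed_norm :: "real \<Rightarrow> real \<Rightarrow> (nat \<Rightarrow> nat \<Rightarrow> real) \<Rightarrow> real" where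
  "mixed_norm p q = lp_norm p (seq_norm q)"

definition mixed_dist :: "real \<Rightarrow> real \<Rightarrow> (nat \<Rightarrow> nat \<Rightarrow> real) \<Rightarrow> (nat \<Rightarrow> nat \<Rightarrow> real) \<Rightarrow> real" where
  "mixed_dist p q x y = mixed_norm p q (x - y)"

definition conj_exponent :: "real \<Rightarrow> ereal" where
  "conj_exponent p = (if p = 1 then \<infinity> else ereal (p / (p - 1)))"

lemma conj_exponent_iff:
  assumes "1 \<le> p"
  shows "r = conj_exponent p \<longleftrightarrow> 1 \<le> r \<and> 1 / ereal p + 1 / r = 1"
proof (cases r)
  case (real t)
  show ?thesis
  proof (cases "1 \<le> t")
    case True
    then show ?thesis using assms real
      by (auto simp: conj_exponent_def one_ereal_def divide_simps) (auto simp: algebra_simps)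
  next
    case False
    moreover have "p > 1 \<Longrightarrow> p / (p - 1) \<ge> 1" by simp
    ultimately show ?thesis using assms real
      by (auto simp: conj_exponent_def one_ereal_def)
  qed
next
  case PInf
  then show ?thesis using assms
    by (auto simp: conj_exponent_def one_ereal_def divide_simps)
next
  case MInf
  then show ?thesis using assms
    by (auto simp: conj_exponent_def)
qed

lemma convex_on_powr_nonneg:
  assumes "1 \<le> p"
  shows "convex_on {0..} (\<lambda>x::real. x powr p)"
proof (rule convex_onI)
  fix t x y :: real
  assume t: "0 < t" "t < 1" and xy: "x \<in> {0..}" "y \<in> {0..}"
  have le: "s powr p \<le> s" if "0 < s" "s < 1" for s :: real
    using powr_mono'[of 1 p s] that assms by simp
  consider "x = 0" | "y = 0" | "x > 0" "y > 0" using xy by force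
  then show "((1 - t) *\<^sub>R x + t *\<^sub>R y) powr p \<le> (1 - t) * x powr p + t * y powr p"
  proof cases
    case 1
    then show ?thesis using t xy le[of t] by (simp add: powr_mult mult_right_mono)
  next
    case 2
    then show ?thesis using t xy le[of "1 - t"] by (simp add: powr_mult mult_right_mono)
  next
    case 3
    then show ?thesis using convex_onD[OF powr_convex[OF assms], of t x y] t by simp
  qed
qed simp

lemma minkowski_aux:
  fixes a b :: "nat \<Rightarrow> real"
  assumes p: "1 \<le> p" and a: "\<And>n. 0 \<le> a n" and b: "\<And>n. 0 \<le> b n"
    and sa: "summable (\<lambda>n. a n powr p)" and sb: "summable (\<lambda>n. b n powr p)"
  shows "summable (\<lambda>n. (a n + b n) powr p) \<and>
    (\<Sum>n. (a n + b n) powr p) powr (1/p)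
      \<le> (\<Sum>n. a n powr p) powr (1/p) + (\<Sum>n. b n powr p) powr (1/p)"
proof -
  define A where "A = (\<Sum>n. a n powr p) powr (1/p)"
  define B where "B = (\<Sum>n. b n powr p) powr (1/p)"
  have Ap: "A powr p = (\<Sum>n. a n powr p)" and Bp: "B powr p = (\<Sum>n. b n powr p)"
    using p suminf_nonneg[OF sa] suminf_nonneg[OF sb] by (auto simp: A_def B_def powr_powr)
  have A0: "A \<ge> 0" and B0: "B \<ge> 0" by (auto simp: A_def B_def)
  show ?thesis
  proof (cases "A = 0 \<or> B = 0")
    case True
    then have "(\<forall>n. a n = 0) \<or> (\<forall>n. b n = 0)"
      using Ap Bp suminf_eq_zero_iff[OF sa] suminf_eq_zero_iff[OF sb] p by auto
    then show ?thesis using sa sb p by auto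
  next
    case False
    then have A: "A > 0" and B: "B > 0" using A0 B0 by auto
    define f where "f n = (A+B) powr p * (A/(A+B) * (a n powr p / A powr p) + B/(A+B) * (b n powr p / B powr p))" for n
    have le: "(a n + b n) powr p \<le> f n" for n
    proof -
      have cv: "convex_on {0..} (\<lambda>x. x powr p)" using p by (rule convex_on_powr_nonneg)
      have "(A/(A+B) * (a n / A) + B/(A+B) * (b n / B)) powr p
        \<le> A/(A+B) * (a n / A) powr p + B/(A+B) * (b n / B) powr p"
        using convex_onD[OF cv, of "B/(A+B)" "a n / A" "b n / B"] A B a b
        by (simp add: field_simps)
      moreover have "A/(A+B) * (a n / A) + B/(A+B) * (b n / B) = (a n + b n) / (A+B)"
        using A B by (simp add: add_divide_distrib)
      ultimately have "((a n + b n)/(A+B)) powr p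
        \<le> A/(A+B) * (a n powr p / A powr p) + B/(A+B) * (b n powr p / B powr p)"
        using A B a b by (simp add: powr_divide)
      then have "(A+B) powr p * ((a n + b n)/(A+B)) powr p \<le> f n"
        unfolding f_def by (intro mult_left_mono) auto
      moreover have "(A+B) powr p * ((a n + b n)/(A+B)) powr p = (a n + b n) powr p"
        using A B a b by (simp add: powr_divide)
      ultimately show ?thesis by simp
    qed
    have "(\<lambda>n. f n) sums ((A+B) powr p * (A/(A+B) * (A powr p / A powr p) + B/(A+B) * (B powr p / B powr p)))"
      unfolding f_def
      by (intro sums_mult sums_add sums_divide) (use sa sb Ap Bp in \<open>auto simp: summable_sums\<close>)
    moreover have "A/(A+B) + B/(A+B) = 1" using A B by (simp add: add_divide_distrib[symmetric])
    ultimately have f: "f sums ((A+B) powr p)" using A B by simp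
    have s: "summable (\<lambda>n. (a n + b n) powr p)"
      by (rule summable_comparison_test'[OF sums_summable[OF f], of 0]) (use le in auto)
    have "(\<Sum>n. (a n + b n) powr p) \<le> (A+B) powr p"
      using suminf_le[OF le s sums_summable[OF f]] sums_unique[OF f] by simp
    then have "(\<Sum>n. (a n + b n) powr p) powr (1/p) \<le> ((A+B) powr p) powr (1/p)"
      using p by (intro powr_mono2) (auto intro: suminf_nonneg s)
    also have "\<dots> = A + B" using p A B by (simp add: powr_powr)
    finally show ?thesis using s by (simp add: A_def B_def)
  qed
qed

lemma lp_space_metric:
  fixes S :: "'a::minus set"
  assumes p: "1 \<le> p" and m: "Metric_space S (\<lambda>x y. N (x - y))"
    and cl: "\<And>x y. x \<in> S \<Longrightarrow> y \<in> S \<Longrightarrow> x - y \<in> S"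
    and N0: "\<And>x. 0 \<le> N x"
    and tri: "\<And>x y. x \<in> S \<Longrightarrow> y \<in> S \<Longrightarrow> N (x - y) \<le> N x + N y"
  shows "Metric_space (lp_space p S N) (\<lambda>x y. lp_norm p N (x - y))"
    and "\<And>x y. x \<in> lp_space p S N \<Longrightarrow> y \<in> lp_space p S N \<Longrightarrow> x - y \<in> lp_space p S N"
    and "\<And>x. 0 \<le> lp_norm p N x"
    and "\<And>x y. x \<in> lp_space p S N \<Longrightarrow> y \<in> lp_space p S N
           \<Longrightarrow> lp_norm p N (x - y) \<le> lp_norm p N x + lp_norm p N y"
proof -
  interpret Metric_space S "\<lambda>x y. N (x - y)" by (rule m)
  have dom: "summable (\<lambda>n. c n powr p) \<and> (\<Sum>n. c n powr p) powr (1/p)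
      \<le> (\<Sum>n. a n powr p) powr (1/p) + (\<Sum>n. b n powr p) powr (1/p)"
    if "\<And>n. 0 \<le> a n" "\<And>n. 0 \<le> b n" "\<And>n. 0 \<le> c n" "\<And>n. c n \<le> a n + b n"
      "summable (\<lambda>n. a n powr p)" "summable (\<lambda>n. b n powr p)" for a b c :: "nat \<Rightarrow> real"
  proof -
    note M = minkowski_aux[OF p that(1,2,5,6)]
    have le: "c n powr p \<le> (a n + b n) powr p" for n
      using that p by (intro powr_mono2) auto
    have s: "summable (\<lambda>n. c n powr p)"
      by (rule summable_comparison_test'[OF conjunct1[OF M], of 0]) (use le in auto)
    have "(\<Sum>n. c n powr p) powr (1/p) \<le> (\<Sum>n. (a n + b n) powr p) powr (1/p)"
      using p s by (intro powr_mono2 suminf_le le conjunct1[OF M]) (auto intro: suminf_nonneg)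
    then show ?thesis using s M by linarith
  qed
  show 1: "x - y \<in> lp_space p S N" if "x \<in> lp_space p S N" "y \<in> lp_space p S N" for x y
    using that dom[of "\<lambda>n. N (x n)" "\<lambda>n. N (y n)" "\<lambda>n. N (x n - y n)"] cl N0 tri
    by (auto simp: lp_space_def)
  show "lp_norm p N (x - y) \<le> lp_norm p N x + lp_norm p N y"
    if "x \<in> lp_space p S N" "y \<in> lp_space p S N" for x y
    using that dom[of "\<lambda>n. N (x n)" "\<lambda>n. N (y n)" "\<lambda>n. N (x n - y n)"] cl N0 tri
    by (auto simp: lp_space_def lp_norm_def)
  show "0 \<le> lp_norm p N x" for x by (simp add: lp_norm_def)
  show "Metric_space (lp_space p S N) (\<lambda>x y. lp_norm p N (x - y))"
  proof
    fix x y show "0 \<le> lp_norm p N (x - y)" by (simp add: lp_norm_def)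
    show "lp_norm p N (x - y) = lp_norm p N (y - x)"
      using commute by (simp add: lp_norm_def)
  next
    fix x y assume xy: "x \<in> lp_space p S N" "y \<in> lp_space p S N"
    have s: "summable (\<lambda>n. N (x n - y n) powr p)" using 1[OF xy] by (simp add: lp_space_def)
    have "(\<Sum>n. N (x n - y n) powr p) = 0 \<longleftrightarrow> (\<forall>n. N (x n - y n) = 0)"
      using suminf_eq_zero_iff[OF s] by simp
    also have "\<dots> \<longleftrightarrow> x = y" using xy zero by (auto simp: lp_space_def fun_eq_iff)
    finally show "lp_norm p N (x - y) = 0 \<longleftrightarrow> x = y" by (simp add: lp_norm_def)
  next
    fix x y z assume xyz: "x \<in> lp_space p S N" "y \<in> lp_space p S N" "z \<in> lp_space p S N"
    show "lp_norm p N (x - z) \<le> lp_norm p N (x - y) + lp_norm p N (y - z)"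
      using 1[OF xyz(1,2)] 1[OF xyz(2,3)] xyz triangle N0
        dom[of "\<lambda>n. N (x n - y n)" "\<lambda>n. N (y n - z n)" "\<lambda>n. N (x n - z n)"]
      by (auto simp: lp_space_def lp_norm_def)
  qed
qed

lemma mixed_Metric_space:
  assumes "1 \<le> p" "1 \<le> q"
  shows "Metric_space (mixed_space p q) (mixed_dist p q)"
proof -
  have m: "Metric_space (UNIV :: real set) (\<lambda>x y. \<bar>x - y\<bar>)"
    by unfold_locales auto
  note 1 = lp_space_metric[OF \<open>1 \<le> q\<close> m, folded seq_space_def seq_norm_def]
  show ?thesis
    unfolding mixed_space_def mixed_dist_def mixed_norm_def
    by (rule lp_space_metric(1)[OF \<open>1 \<le> p\<close>])
      (use 1 in \<open>blast intro: abs_triangle_ineq4 abs_ge_zero\<close>)+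
qed

end

theory Submission
  imports Defs
begin

text \<open>
  Write \<open>m\<close> for the claimed value \<open>min(p, p', q, q')\<close>.

  Roundness cannot exceed \<open>m\<close> because the space contains isometric copies of the planes
  \<open>\<ell>\<^sup>p\<close> and \<open>\<ell>\<^sup>q\<close> of dimension two. In such a plane, the four points \<open>0, e1 + e2, e1, e2\<close>
  force \<open>r \<le> p\<close>, and \<open>0, 2 e1, e1 + e2, e1 - e2\<close> force \<open>r \<le> p'\<close>
  (\<open>has_roundness_le_if_plane_embeds\<close>).

  Roundness \<open>1\<close> is the triangle inequality, so let \<open>m > 1\<close>; then \<open>m \<le> 2\<close>. The roundness inequality
  does not itself pass through \<open>\<ell>\<^sup>p\<close>-sums in an obvious way. Clarkson's stronger inequality does:
  there the left-hand exponent is \<open>m\<close> but the average on the left is taken with the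
  conjugate exponent \<open>s = m'\<close>. For four points it reads
  \<open>((d(a1,a2)^s + d(b1,b2)^s) / 2)^(m/s) \<le> (d(a1,b1)^m + d(a1,b2)^m + d(a2,b1)^m + d(a2,b2)^m) / 2\<close>,
  and it involves distances only (\<open>clarkson_roundness\<close>). On the real line it follows from the
  scalar Clarkson inequality, by Friedrichs' monotonicity argument. If \<open>m \<le> p \<le> s\<close>, it is
  inherited by \<open>\<ell>\<^sup>p\<close>-sums, by Minkowski's inequality once with exponent \<open>s/p\<close> on the left and once
  with exponent \<open>p/m\<close> on the right (\<open>lp_clarkson_inequality\<close>). Since \<open>m \<le> p'\<close> says the same as
  \<open>p \<le> s\<close>, and likewise for \<open>q\<close>, this applies to both sums that build the space. Finally, comparing the
  power means with exponents \<open>m\<close> and \<open>s\<close> gives roundness \<open>m\<close>.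
\<close>

section \<open>Clarkson's inequality for real numbers\<close>

text \<open>
  Friedrichs' proof. The function \<open>f(\<alpha>) = (1 + \<alpha>^(1-s) x) (1 + \<alpha> x)^(s-1) + (1 - \<alpha>^(1-s) x) (1 - \<alpha> x)^(s-1)\<close>
  interpolates between twice the left-hand side at \<open>\<alpha> = 1\<close> and twice the right-hand side at
  \<open>\<alpha> = x^(r-1)\<close>, and it decreases on \<open>{0<..1}\<close>. The last fact needs \<open>s \<ge> 2\<close>, which is \<open>r \<le> 2\<close>.
\<close>

lemma friedrichs_inequality:
  fixes x :: real
  assumes r: "1 < r" "r \<le> 2" and s: "s = r / (r - 1)" and x: "0 \<le> x" "x \<le> 1"
  shows "((1 + x) powr s + (1 - x) powr s) / 2 \<le> (1 + x powr r) powr (s - 1)"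
proof -
  have s2: "2 \<le> s" using r by (simp add: s field_simps)
  have rs: "(r - 1) * (s - 1) = 1" "(r - 1) * s = r" using r by (auto simp: s field_simps)
  consider "x = 0" | "x = 1" | "0 < x" "x < 1" using x by linarith
  then show ?thesis
  proof cases
    case 1
    then show ?thesis using r by simp
  next
    case 2
    then show ?thesis using s2 by (simp add: powr_diff)
  next
    case 3
    define f where "f \<alpha> = (1 + \<alpha> powr (1 - s) * x) * (1 + \<alpha> * x) powr (s - 1)
      + (1 - \<alpha> powr (1 - s) * x) * (1 - \<alpha> * x) powr (s - 1)" for \<alpha>
    define \<alpha>0 where "\<alpha>0 = x powr (r - 1)"
    have \<alpha>0: "0 < \<alpha>0" "\<alpha>0 \<le> 1" using 3 r by (auto simp: \<alpha>0_def powr_le1)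
    have "f 1 \<le> f \<alpha>0"
    proof (rule DERIV_nonpos_imp_nonincreasing[OF \<alpha>0(2)])
      fix \<alpha> assume \<alpha>: "\<alpha>0 \<le> \<alpha>" "\<alpha> \<le> 1"
      have a: "0 < \<alpha>" using \<alpha> \<alpha>0 by linarith
      have ax: "0 < \<alpha> * x" "\<alpha> * x < 1" using a 3 \<alpha> mult_strict_right_mono[of 0 \<alpha> x] mult_right_mono[of \<alpha> 1 x] by linarith+
      \<comment> \<open>Both factors that remain besides \<open>(s - 1) * x\<close> have a visible sign.\<close>
      have d: "(f has_real_derivative
         (s - 1) * x * (1 - \<alpha> powr (-s)) * ((1 + \<alpha> * x) powr (s - 2) - (1 - \<alpha> * x) powr (s - 2))) (at \<alpha>)"
      proof -
        have split: "(1 + \<alpha> * x) powr (s - 1) = (1 + \<alpha> * x) powr (s - 2) * (1 + \<alpha> * x)"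
          "(1 - \<alpha> * x) powr (s - 1) = (1 - \<alpha> * x) powr (s - 2) * (1 - \<alpha> * x)"
          "\<alpha> powr (1 - s) = \<alpha> powr (- s) * \<alpha>"
          using ax a powr_add[of "1 + \<alpha> * x" "s - 2" 1] powr_add[of "1 - \<alpha> * x" "s - 2" 1]
            powr_add[of \<alpha> "- s" 1]
          by (auto simp: algebra_simps)
        have "(f has_real_derivative
          ((1 - s) * \<alpha> powr (-s) * x) * (1 + \<alpha> * x) powr (s - 1)
          + (1 + \<alpha> powr (1 - s) * x) * ((s - 1) * (1 + \<alpha> * x) powr (s - 2) * x)
          - ((1 - s) * \<alpha> powr (-s) * x) * (1 - \<alpha> * x) powr (s - 1)
          - (1 - \<alpha> powr (1 - s) * x) * ((s - 1) * (1 - \<alpha> * x) powr (s - 2) * x)) (at \<alpha>)"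
          unfolding f_def
          by (rule derivative_eq_intros refl | use a ax in \<open>simp add: algebra_simps\<close>)+
        then show ?thesis
          unfolding split by (rule DERIV_cong) (simp add: algebra_simps)
      qed
      have "1 \<le> \<alpha> powr (- s)" using a \<alpha> s2 powr_mono'[of "-s" 0 \<alpha>] by simp
      moreover have "(1 - \<alpha> * x) powr (s - 2) \<le> (1 + \<alpha> * x) powr (s - 2)"
        using ax s2 by (intro powr_mono2) auto
      ultimately have "(s - 1) * x * (1 - \<alpha> powr (-s))
           * ((1 + \<alpha> * x) powr (s - 2) - (1 - \<alpha> * x) powr (s - 2)) \<le> 0"
        using s2 3 by (intro mult_nonpos_nonneg mult_nonneg_nonpos) auto
      then show "\<exists>y. (f has_real_derivative y) (at \<alpha>) \<and> y \<le> 0" using d by blast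
    qed
    moreover have "f \<alpha>0 = 2 * (1 + x powr r) powr (s - 1)"
    proof -
      \<comment> \<open>At this point the second summand of \<open>f\<close> vanishes.\<close>
      have "(r - 1) * (1 - s) = - 1" using rs by (simp add: algebra_simps)
      then have "\<alpha>0 powr (1 - s) * x = 1" 
        using 3 by (simp add: \<alpha>0_def powr_powr powr_minus_divide)
      moreover have "\<alpha>0 * x = x powr r" 
        using 3 powr_add[of x "r - 1" 1] by (simp add: \<alpha>0_def)
      ultimately show ?thesis by (simp add: f_def)
    qed
    moreover have "f 1 = (1 + x) powr s + (1 - x) powr s"
      using 3 powr_add[of "1 + x" 1 "s - 1"] powr_add[of "1 - x" 1 "s - 1"] by (simp add: f_def)
    ultimately show ?thesis by simp
  qed
qed

text \<open>
  By symmetry \<open>0 \<le> b \<le> a\<close>; dividing by \<open>a\<close> reduces the claim to Friedrichs' inequality raised to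
  the power \<open>r / s = r - 1\<close>, which is the inverse of the exponent \<open>s - 1\<close> there.
\<close>
lemma real_clarkson_inequality:
  fixes a b :: real
  assumes r: "1 < r" "r \<le> 2" and s: "s = r / (r - 1)"
  shows "((\<bar>a + b\<bar> powr s + \<bar>a - b\<bar> powr s) / 2) powr (r / s) \<le> \<bar>a\<bar> powr r + \<bar>b\<bar> powr r"
proof -
  have *: "((\<bar>a + b\<bar> powr s + \<bar>a - b\<bar> powr s) / 2) powr (r / s) \<le> a powr r + b powr r"
    if ab: "0 \<le> b" "b \<le> a" for a b :: real
  proof (cases "a = 0")
    case False
    then have a: "0 < a" using ab by simp
    define x where "x = b / a"
    have x: "0 \<le> x" "x \<le> 1" and b: "b = a * x" using a ab by (auto simp: x_def)
    have rs: "r / s = r - 1" "(s - 1) * (r - 1) = 1" "s > 0" using r by (auto simp: s field_simps)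
    have "\<bar>a + b\<bar> = a * (1 + x)" "\<bar>a - b\<bar> = a * (1 - x)"
      using a x ab by (auto simp: b algebra_simps)
    then have "(\<bar>a + b\<bar> powr s + \<bar>a - b\<bar> powr s) / 2
        = a powr s * (((1 + x) powr s + (1 - x) powr s) / 2)"
      using a x by (simp only: powr_mult) (simp add: algebra_simps add_divide_distrib)
    also have "\<dots> \<le> a powr s * (1 + x powr r) powr (s - 1)"
      by (intro mult_left_mono friedrichs_inequality[OF r s x]) auto
    finally have "((\<bar>a + b\<bar> powr s + \<bar>a - b\<bar> powr s) / 2) powr (r / s)
        \<le> (a powr s * (1 + x powr r) powr (s - 1)) powr (r / s)"
      using r rs by (intro powr_mono2) auto
    also have "\<dots> = a powr r * (1 + x powr r)"
    proof -
      have "(a powr s) powr (r / s) = a powr r" using rs(3) a by (simp add: powr_powr)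
      moreover have "((1 + x powr r) powr (s - 1)) powr (r / s) = 1 + x powr r"
        unfolding rs(1) powr_powr rs(2) by (simp add: add_nonneg_nonneg)
      ultimately show ?thesis by (simp add: powr_mult)
    qed
    also have "\<dots> = a powr r + b powr r" using a x by (simp add: b powr_mult algebra_simps)
    finally show ?thesis .
  qed (use ab in simp)
  consider "\<bar>b\<bar> \<le> \<bar>a\<bar>" | "\<bar>a\<bar> \<le> \<bar>b\<bar>" by linarith
  then show ?thesis
  proof cases
    case 1
    have "{\<bar>\<bar>a\<bar> + \<bar>b\<bar>\<bar>, \<bar>\<bar>a\<bar> - \<bar>b\<bar>\<bar>} = {\<bar>a + b\<bar>, \<bar>a - b\<bar>}" by (auto simp: abs_if)
    then show ?thesis using *[OF _ 1] by (auto simp: doubleton_eq_iff add.commute)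
  next
    case 2
    have "{\<bar>\<bar>b\<bar> + \<bar>a\<bar>\<bar>, \<bar>\<bar>b\<bar> - \<bar>a\<bar>\<bar>} = {\<bar>a + b\<bar>, \<bar>a - b\<bar>}" by (auto simp: abs_if)
    then show ?thesis using *[OF _ 2] by (auto simp: doubleton_eq_iff add.commute)
  qed
qed

section \<open>The four-point Clarkson inequality\<close>

text \<open>
  For \<open>r = s\<close> this is the roundness inequality; for \<open>s > r\<close> it is stronger. Distances
  alone enter, so that passing to \<open>\<ell>\<^sup>p\<close>-sums uses neither sums nor multiples of vectors.
\<close>
definition clarkson_roundness :: "real \<Rightarrow> real \<Rightarrow> 'a set \<Rightarrow> ('a \<Rightarrow> 'a \<Rightarrow> real) \<Rightarrow> bool" where
  "clarkson_roundness r s S d \<longleftrightarrow>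
     (\<forall>a1\<in>S. \<forall>a2\<in>S. \<forall>b1\<in>S. \<forall>b2\<in>S.
        ((d a1 a2 powr s + d b1 b2 powr s) / 2) powr (r / s)
          \<le> (d a1 b1 powr r + d a1 b2 powr r + d a2 b1 powr r + d a2 b2 powr r) / 2)"

lemma powr_mean:
  fixes u v :: real
  assumes "1 \<le> p" "0 \<le> u" "0 \<le> v"
  shows "((u + v) / 2) powr p \<le> (u powr p + v powr p) / 2"
  using convex_onD[OF convex_on_powr_nonneg[OF assms(1)], of "1 / 2" u v] assms(2,3)
  by (simp add: field_simps)

text \<open>
  In a parallelogram with sides \<open>P\<close> and \<open>Q\<close> this is the scalar inequality. A
  general quadrilateral has the same diagonals as the parallelogram whose sides are the averages of
  opposite sides, and by convexity averaging does not increase the right-hand side.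
\<close>
lemma clarkson_roundness_real:
  assumes r: "1 < r" "r \<le> 2" and s: "s = r / (r - 1)"
  shows "clarkson_roundness r s (UNIV :: real set) (\<lambda>x y. \<bar>x - y\<bar>)"
  unfolding clarkson_roundness_def
proof (intro ballI)
  fix a1 a2 b1 b2 :: real
  have half: "\<bar>(u + v) / 2\<bar> powr r \<le> (\<bar>u\<bar> powr r + \<bar>v\<bar> powr r) / 2" for u v :: real
  proof -
    have "\<bar>(u + v) / 2\<bar> powr r \<le> ((\<bar>u\<bar> + \<bar>v\<bar>) / 2) powr r"
      using r by (intro powr_mono2) auto
    also have "\<dots> \<le> (\<bar>u\<bar> powr r + \<bar>v\<bar> powr r) / 2" using r by (intro powr_mean) auto
    finally show ?thesis .
  qed
  define P where "P = ((a1 - b1) + (b2 - a2)) / 2"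
  define Q where "Q = ((a1 - b2) + (b1 - a2)) / 2"
  have PQ: "P + Q = a1 - a2" "P - Q = - (b1 - b2)" by (auto simp: P_def Q_def field_simps)
  have "((\<bar>a1 - a2\<bar> powr s + \<bar>b1 - b2\<bar> powr s) / 2) powr (r / s) \<le> \<bar>P\<bar> powr r + \<bar>Q\<bar> powr r"
    using real_clarkson_inequality[OF r s, of P Q] unfolding PQ by (simp only: abs_minus_cancel)
  also have "\<dots> \<le> (\<bar>a1 - b1\<bar> powr r + \<bar>b2 - a2\<bar> powr r) / 2 + (\<bar>a1 - b2\<bar> powr r + \<bar>b1 - a2\<bar> powr r) / 2"
    unfolding P_def Q_def by (intro add_mono half)
  finally show "((\<bar>a1 - a2\<bar> powr s + \<bar>b1 - b2\<bar> powr s) / 2) powr (r / s)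
    \<le> (\<bar>a1 - b1\<bar> powr r + \<bar>a1 - b2\<bar> powr r + \<bar>a2 - b1\<bar> powr r + \<bar>a2 - b2\<bar> powr r) / 2"
    by (simp add: abs_minus_commute add_divide_distrib)
qed

section \<open>Passage to sums of spaces\<close>

lemma minkowski_sum:
  fixes a :: "'i \<Rightarrow> nat \<Rightarrow> real"
  assumes p: "1 \<le> p" and "finite I"
    and "\<And>i n. i \<in> I \<Longrightarrow> 0 \<le> a i n" and "\<And>i. i \<in> I \<Longrightarrow> summable (\<lambda>n. a i n powr p)"
  shows "summable (\<lambda>n. (\<Sum>i\<in>I. a i n) powr p) \<and>
    (\<Sum>n. (\<Sum>i\<in>I. a i n) powr p) powr (1/p) \<le> (\<Sum>i\<in>I. (\<Sum>n. a i n powr p) powr (1/p))"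
  using assms(2-)
proof (induction I rule: finite_induct)
  case (insert i I)
  then have IH: "summable (\<lambda>n. (\<Sum>i\<in>I. a i n) powr p)"
    "(\<Sum>n. (\<Sum>i\<in>I. a i n) powr p) powr (1/p) \<le> (\<Sum>i\<in>I. (\<Sum>n. a i n powr p) powr (1/p))"
    by auto
  have "summable (\<lambda>n. (a i n + (\<Sum>i\<in>I. a i n)) powr p) \<and>
    (\<Sum>n. (a i n + (\<Sum>i\<in>I. a i n)) powr p) powr (1/p)
      \<le> (\<Sum>n. a i n powr p) powr (1/p) + (\<Sum>n. (\<Sum>i\<in>I. a i n) powr p) powr (1/p)"
    using insert IH(1) by (intro minkowski_aux[OF p]) (auto intro: sum_nonneg)
  then show ?case using IH(2) insert by auto
qed simp

text \<open>
  This is the triangle inequality for a series of vectors \<open>(u n, v n)\<close> in the plane with the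
  \<open>\<ell>\<^sup>t\<close>-norm. The finite case is Minkowski's inequality for sequences supported on two places.
\<close>
lemma minkowski_pair_suminf:
  fixes u v :: "nat \<Rightarrow> real"
  assumes t: "1 \<le> t" and u: "\<And>n. 0 \<le> u n" "summable u" and v: "\<And>n. 0 \<le> v n" "summable v"
    and sm: "summable (\<lambda>n. (u n powr t + v n powr t) powr (1/t))"
  shows "(suminf u powr t + suminf v powr t) powr (1/t)
    \<le> (\<Sum>n. (u n powr t + v n powr t) powr (1/t))"
proof (rule LIMSEQ_le_const2)
  show "(\<lambda>N. (sum u {..<N} powr t + sum v {..<N} powr t) powr (1/t))
    \<longlonglongrightarrow> (suminf u powr t + suminf v powr t) powr (1/t)"
    using t u v by (intro tendsto_powr2 tendsto_add tendsto_powr' summable_LIMSEQ tendsto_const)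
      (auto intro!: always_eventually add_nonneg_nonneg suminf_nonneg sum_nonneg)
  have two: "(\<lambda>k::nat. h k powr t) sums (h 0 powr t + h 1 powr t)" if "\<And>k. 2 \<le> k \<Longrightarrow> h k = 0" for h :: "nat \<Rightarrow> real"
    using sums_finite[of "{0, 1}" "\<lambda>k. h k powr t"] that t by force
  \<comment> \<open>The \<open>n\<close>-th summand, a vector in the plane, as a sequence indexed by \<open>k\<close>.\<close>
  define a where "a n k = (if k = 0 then u n else if k = 1 then v n else 0)" for n and k :: nat
  have "(sum u {..<N} powr t + sum v {..<N} powr t) powr (1/t)
      \<le> (\<Sum>n. (u n powr t + v n powr t) powr (1/t))" for N
  proof -
    have "(sum u {..<N} powr t + sum v {..<N} powr t) powr (1/t)
        = (\<Sum>k. (\<Sum>n<N. a n k) powr t) powr (1/t)"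
      using sums_unique[OF two[of "\<lambda>k. \<Sum>n<N. a n k"]] by (simp add: a_def)
    also have "\<dots> \<le> (\<Sum>n<N. (\<Sum>k. a n k powr t) powr (1/t))"
      using u v sums_summable[OF two[of "a _"]]
      by (intro conjunct2[OF minkowski_sum[OF t]]) (auto simp: a_def)
    also have "\<dots> = (\<Sum>n<N. (u n powr t + v n powr t) powr (1/t))"
      using sums_unique[OF two[of "a _"]] by (simp add: a_def)
    also have "\<dots> \<le> (\<Sum>n. (u n powr t + v n powr t) powr (1/t))"
      by (intro sum_le_suminf sm) auto
    finally show ?thesis .
  qed
  then show "\<exists>N. \<forall>n\<ge>N. (sum u {..<n} powr t + sum v {..<n} powr t) powr (1/t)
      \<le> (\<Sum>n. (u n powr t + v n powr t) powr (1/t))" by blast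
qed

text \<open>
  With \<open>t = s / p\<close>, the left-hand side is a power of the \<open>\<ell>\<^sup>t\<close>-norm of a sum over \<open>n\<close> of vectors
  with entries \<open>u n powr p\<close> and \<open>v n powr p\<close>; the triangle inequality, where \<open>p \<le> s\<close> enters, moves
  the sum over \<open>n\<close> outside. The hypothesis then applies to every \<open>n\<close>. Minkowski's inequality with
  exponent \<open>p / r\<close>, where \<open>r \<le> p\<close> enters, moves the sum over \<open>I\<close> outside.
\<close>
lemma lp_clarkson_inequality:
  fixes u v :: "nat \<Rightarrow> real" and w :: "'i \<Rightarrow> nat \<Rightarrow> real"
  assumes r: "0 < r" "r \<le> p" and s: "p \<le> s" and I: "finite I"
    and u: "\<And>n. 0 \<le> u n" "summable (\<lambda>n. u n powr p)"
    and v: "\<And>n. 0 \<le> v n" "summable (\<lambda>n. v n powr p)"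
    and w: "\<And>i n. i \<in> I \<Longrightarrow> 0 \<le> w i n" "\<And>i. i \<in> I \<Longrightarrow> summable (\<lambda>n. w i n powr p)"
    and le: "\<And>n. ((u n powr s + v n powr s) / 2) powr (r / s) \<le> (\<Sum>i\<in>I. w i n powr r / 2)"
  shows "((((\<Sum>n. u n powr p) powr (1/p)) powr s + ((\<Sum>n. v n powr p) powr (1/p)) powr s) / 2) powr (r / s)
    \<le> (\<Sum>i\<in>I. ((\<Sum>n. w i n powr p) powr (1/p)) powr r / 2)"
proof -
  have p: "0 < p" "0 < s" using r s by auto
  define W where "W n = (\<Sum>i\<in>I. w i n powr r / 2)" for n
  have half: "(y powr r / 2) powr (p / r) = y powr p / 2 powr (p / r)" for y :: real
    using r by (simp add: powr_divide powr_powr)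
  have W: "summable (\<lambda>n. W n powr (p / r)) \<and> (\<Sum>n. W n powr (p / r)) powr (1 / (p / r))
      \<le> (\<Sum>i\<in>I. (\<Sum>n. (w i n powr r / 2) powr (p / r)) powr (1 / (p / r)))"
    unfolding W_def by (rule minkowski_sum) (use r I w in \<open>auto simp: half summable_divide\<close>)
  \<comment> \<open>Dividing the \<open>p\<close>-th powers by this constant turns sums of two \<open>s\<close>-th powers into averages.\<close>
  define c where "c = (2::real) powr (p / s)"
  have c: "0 < c" by (simp add: c_def)
  have ct: "(y powr p / c) powr (s / p) = y powr s / 2" for y :: real
    using p by (simp add: powr_divide powr_powr c_def)
  define E where "E n = ((u n powr p / c) powr (s/p) + (v n powr p / c) powr (s/p)) powr (1 / (s/p))" for n
  have EW: "E n \<le> W n powr (p / r)" for n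
  proof -
    have "E n = (((u n powr s + v n powr s) / 2) powr (r / s)) powr (p / r)"
      using r by (simp add: E_def ct powr_powr add_divide_distrib)
    also have "\<dots> \<le> W n powr (p / r)"
      using le[of n] r unfolding W_def by (intro powr_mono2) auto
    finally show ?thesis .
  qed
  have sE: "summable E"
    by (rule summable_comparison_test'[OF conjunct1[OF W], of 0]) (use EW in \<open>auto simp: E_def\<close>)
  have norm: "((\<Sum>n. y n powr p / c) powr (s / p)) = ((\<Sum>n. y n powr p) powr (1/p)) powr s / 2"
    if "summable (\<lambda>n. y n powr p)" for y :: "nat \<Rightarrow> real"
  proof -
    have "(\<Sum>n. y n powr p / c) = (\<Sum>n. y n powr p) / c" using that by (rule suminf_divide)
    then show ?thesis
      using p suminf_nonneg[OF that] by (simp add: powr_divide powr_powr c_def)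
  qed
  have "(((\<Sum>n. u n powr p / c) powr (s/p) + (\<Sum>n. v n powr p / c) powr (s/p)) powr (1 / (s/p)))
      \<le> (\<Sum>n. E n)"
    unfolding E_def
    by (rule minkowski_pair_suminf) (use c p s u v sE[unfolded E_def[abs_def]] in \<open>auto simp: summable_divide\<close>)
  also have "\<dots> \<le> (\<Sum>n. W n powr (p / r))" using EW sE W by (intro suminf_le) auto
  finally have "((((\<Sum>n. u n powr p / c) powr (s/p) + (\<Sum>n. v n powr p / c) powr (s/p)) powr (1 / (s/p)))) powr (r / p)
      \<le> (\<Sum>n. W n powr (p / r)) powr (r / p)"
    using r p by (intro powr_mono2) auto
  then have "((((\<Sum>n. u n powr p) powr (1/p)) powr s + ((\<Sum>n. v n powr p) powr (1/p)) powr s) / 2) powr (r / s)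
      \<le> (\<Sum>n. W n powr (p / r)) powr (r / p)"
    unfolding norm[OF u(2)] norm[OF v(2)] using p by (simp add: powr_powr add_divide_distrib)
  also have "\<dots> \<le> (\<Sum>i\<in>I. (\<Sum>n. (w i n powr r / 2) powr (p / r)) powr (r / p))" using W by simp
  also have "\<dots> = (\<Sum>i\<in>I. ((\<Sum>n. w i n powr p) powr (1/p)) powr r / 2)"
  proof (rule sum.cong)
    fix i assume i: "i \<in> I"
    have "(\<Sum>n. w i n powr p / 2 powr (p / r)) = (\<Sum>n. w i n powr p) / 2 powr (p / r)"
      using w(2)[OF i] by (rule suminf_divide)
    then show "(\<Sum>n. (w i n powr r / 2) powr (p / r)) powr (r / p)
        = ((\<Sum>n. w i n powr p) powr (1/p)) powr r / 2"
      using r p suminf_nonneg[OF w(2)[OF i]] by (simp add: half powr_divide powr_powr)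
  qed simp
  finally show ?thesis .
qed

lemma clarkson_roundness_lp_space:
  fixes S :: "'a::minus set"
  assumes r: "0 < r" "r \<le> p" and s: "p \<le> s"
    and C: "clarkson_roundness r s S (\<lambda>x y. N (x - y))" and N0: "\<And>x. 0 \<le> N x"
    and cl: "\<And>x y. x \<in> lp_space p S N \<Longrightarrow> y \<in> lp_space p S N \<Longrightarrow> x - y \<in> lp_space p S N"
  shows "clarkson_roundness r s (lp_space p S N) (\<lambda>x y. lp_norm p N (x - y))"
  unfolding clarkson_roundness_def
proof (intro ballI)
  fix a1 a2 b1 b2
  assume A: "a1 \<in> lp_space p S N" "a2 \<in> lp_space p S N" "b1 \<in> lp_space p S N" "b2 \<in> lp_space p S N"
  have sm: "summable (\<lambda>n. N (x n - y n) powr p)"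
    if "x \<in> lp_space p S N" "y \<in> lp_space p S N" for x y
    using cl[OF that] by (simp add: lp_space_def)
  \<comment> \<open>The indices 0, 1, 2, 3 enumerate the sides \<open>a1 b1\<close>, \<open>a1 b2\<close>, \<open>a2 b1\<close>, \<open>a2 b2\<close>.\<close>
  define w where "w i n = N ((if i = 0 \<or> i = 1 then a1 else a2) n - (if i = 0 \<or> i = 2 then b1 else b2) n)" for i n :: nat
  have "((((\<Sum>n. N (a1 n - a2 n) powr p) powr (1/p)) powr s + ((\<Sum>n. N (b1 n - b2 n) powr p) powr (1/p)) powr s) / 2) powr (r / s)
    \<le> (\<Sum>i<4. ((\<Sum>n. w i n powr p) powr (1/p)) powr r / 2)"
  proof (rule lp_clarkson_inequality[OF r s])
    show "((N (a1 n - a2 n) powr s + N (b1 n - b2 n) powr s) / 2) powr (r / s)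
      \<le> (\<Sum>i<4. w i n powr r / 2)" for n
    proof -
      have "a1 n \<in> S" "a2 n \<in> S" "b1 n \<in> S" "b2 n \<in> S" using A by (auto simp: lp_space_def)
      then show ?thesis
        using C unfolding clarkson_roundness_def
        by (simp add: w_def eval_nat_numeral add_divide_distrib)
    qed
  qed (use A sm N0 in \<open>auto simp: w_def\<close>)
  then show "((lp_norm p N (a1 - a2) powr s + lp_norm p N (b1 - b2) powr s) / 2) powr (r / s)
    \<le> (lp_norm p N (a1 - b1) powr r + lp_norm p N (a1 - b2) powr r
        + lp_norm p N (a2 - b1) powr r + lp_norm p N (a2 - b2) powr r) / 2"
    by (simp add: lp_norm_def w_def eval_nat_numeral add_divide_distrib)
qed

lemma clarkson_roundness_mixed_space:
  assumes r: "1 < r" "r \<le> 2" and s: "s = r / (r - 1)"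
    and p: "r \<le> p" "p \<le> s" and q: "r \<le> q" "q \<le> s"
  shows "clarkson_roundness r s (mixed_space p q) (mixed_dist p q)"
proof -
  have m: "Metric_space (UNIV :: real set) (\<lambda>x y. \<bar>x - y\<bar>)"
    by unfold_locales auto
  have pq: "1 \<le> p" "1 \<le> q" using r p q by auto
  note seq = lp_space_metric[OF pq(2) m UNIV_I abs_ge_zero abs_triangle_ineq4,
      folded seq_space_def seq_norm_def]
  have mixed: "x - y \<in> lp_space p (seq_space q) (seq_norm q)"
    if "x \<in> lp_space p (seq_space q) (seq_norm q)" "y \<in> lp_space p (seq_space q) (seq_norm q)" for x y
    by (rule lp_space_metric(2)[OF pq(1) seq(1) _ _ _ that]) (use seq in blast)+
  have C: "clarkson_roundness r s (seq_space q) (\<lambda>x y. seq_norm q (x - y))"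
    unfolding seq_space_def seq_norm_def
    by (rule clarkson_roundness_lp_space[OF _ q clarkson_roundness_real[OF r s]])
      (use r seq(2) in \<open>auto simp: seq_space_def\<close>)
  show ?thesis
    unfolding mixed_space_def mixed_dist_def mixed_norm_def
    by (rule clarkson_roundness_lp_space[OF _ p C])
      (use r seq(3) mixed in auto)
qed

section \<open>Roundness\<close>

context Metric_space
begin

text \<open>
  Each diagonal is bounded by a pair of adjacent sides in two ways; adding all four bounds counts
  every diagonal and every side twice.
\<close>
lemma has_roundness_1: "has_roundness 1"
  unfolding has_roundness_def
proof (intro conjI ballI)
  fix a1 a2 b1 b2 assume "a1 \<in> M" "a2 \<in> M" "b1 \<in> M" "b2 \<in> M"
  then show "d a1 a2 powr 1 + d b1 b2 powr 1
      \<le> d a1 b1 powr 1 + d a1 b2 powr 1 + d a2 b1 powr 1 + d a2 b2 powr 1"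
    using triangle[of a1 b1 a2] triangle[of a1 b2 a2] triangle[of b1 a1 b2] triangle[of b1 a2 b2]
    by (simp add: commute)
qed simp

text \<open>
  The power mean of the two diagonals increases with its exponent, so the mean with exponent \<open>r\<close> is
  at most the one with exponent \<open>s\<close> that the Clarkson inequality controls.
\<close>
lemma has_roundness_if_clarkson_roundness:
  assumes C: "clarkson_roundness r s M d" and r: "1 \<le> r" "r \<le> s"
  shows "has_roundness r"
  unfolding has_roundness_def
proof (intro conjI ballI)
  fix a1 a2 b1 b2 assume A: "a1 \<in> M" "a2 \<in> M" "b1 \<in> M" "b2 \<in> M"
  have "((d a1 a2 powr r + d b1 b2 powr r) / 2) powr (s / r)
      \<le> (d a1 a2 powr s + d b1 b2 powr s) / 2"
    using powr_mean[of "s / r" "d a1 a2 powr r" "d b1 b2 powr r"] r by (simp add: powr_powr)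
  then have "(((d a1 a2 powr r + d b1 b2 powr r) / 2) powr (s / r)) powr (r / s)
      \<le> ((d a1 a2 powr s + d b1 b2 powr s) / 2) powr (r / s)"
    using r by (intro powr_mono2) auto
  also have "\<dots> \<le> (d a1 b1 powr r + d a1 b2 powr r + d a2 b1 powr r + d a2 b2 powr r) / 2"
    using C A by (simp add: clarkson_roundness_def)
  finally show "d a1 a2 powr r + d b1 b2 powr r
      \<le> d a1 b1 powr r + d a1 b2 powr r + d a2 b1 powr r + d a2 b2 powr r"
    using r by (simp add: powr_powr)
qed (rule r)

text \<open>
  The first quadrilateral has both diagonals of length \<open>2 powr (1 / p)\<close> and all sides of length \<open>1\<close>;
  in the second one the diagonals have length \<open>2\<close> and the sides \<open>2 powr (1 / p)\<close>.
\<close>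
lemma has_roundness_le_if_plane_embeds:
  assumes R: "has_roundness r" and p: "1 \<le> p"
    and f: "\<And>x y. f x y \<in> M"
    and d: "\<And>x y x' y'. d (f x y) (f x' y') = (\<bar>x - x'\<bar> powr p + \<bar>y - y'\<bar> powr p) powr (1 / p)"
  shows "ereal r \<le> ereal p" and "ereal r \<le> conj_exponent p"
proof -
  have r: "1 \<le> r" using R by (simp add: has_roundness_def)
  have R': "d a1 a2 powr r + d b1 b2 powr r
      \<le> d a1 b1 powr r + d a1 b2 powr r + d a2 b1 powr r + d a2 b2 powr r"
    if "a1 \<in> M" "a2 \<in> M" "b1 \<in> M" "b2 \<in> M" for a1 a2 b1 b2
    using R that by (simp add: has_roundness_def)
  have "2 powr (r / p) \<le> 2 powr 1"
    using R'[of "f 0 0" "f 1 1" "f 1 0" "f 0 1"] p by (simp add: d f powr_powr)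
  then have "r / p \<le> 1" by (subst (asm) powr_le_cancel_iff) auto
  then show "ereal r \<le> ereal p" using p by simp
  have "2 * 2 powr r \<le> 4 * 2 powr (r / p)"
    using R'[of "f 0 0" "f 2 0" "f 1 1" "f 1 (-1)"] p by (simp add: d f powr_powr)
  then have "2 powr r \<le> 2 powr (1 + r / p)" by (simp add: powr_add)
  then have "r \<le> 1 + r / p" by (subst (asm) powr_le_cancel_iff) auto
  then show "ereal r \<le> conj_exponent p"
    using p by (auto simp: conj_exponent_def field_simps)
qed

end

lemma lp_space_two_terms:
  assumes "\<And>n. 2 \<le> n \<Longrightarrow> N (x n) = 0"
  shows "summable (\<lambda>n. N (x n) powr p)"
    and "lp_norm p N x = (N (x 0) powr p + N (x 1) powr p) powr (1 / p)"
proof -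
  have "(\<lambda>n. N (x n) powr p) sums (\<Sum>n\<in>{0, 1}. N (x n) powr p)"
  proof (rule sums_finite)
    fix n :: nat assume "n \<notin> {0, 1}"
    then have "2 \<le> n" by auto
    then show "N (x n) powr p = 0" using assms by simp
  qed simp
  then show "summable (\<lambda>n. N (x n) powr p)"
    "lp_norm p N x = (N (x 0) powr p + N (x 1) powr p) powr (1 / p)"
    by (auto simp: sums_iff lp_norm_def)
qed

text \<open>
  The plane with the \<open>\<ell>\<^sup>p\<close>-norm sits in the first entries of the first two inner sequences, the one
  with the \<open>\<ell>\<^sup>q\<close>-norm in the first two entries of the first inner sequence.
\<close>
lemma has_roundness_mixed_space_le:
  assumes p: "1 \<le> p" and q: "1 \<le> q"
    and R: "Metric_space.has_roundness (mixed_space p q) (mixed_dist p q) r"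
  shows "ereal r \<le> Min {ereal p, conj_exponent p, ereal q, conj_exponent q}"
proof -
  interpret Metric_space "mixed_space p q" "mixed_dist p q"
    using p q by (rule mixed_Metric_space)
  define pair where "pair x y n = (if n = 0 then x else if n = 1 then y else 0)" for x y :: real and n :: nat
  define outer where "outer x y n = pair (pair x y n) 0" for x y and n :: nat
  define inner where "inner x y n = (if n = 0 then pair x y else pair 0 0)" for x y and n :: nat
  have diff: "pair x y - pair x' y' = pair (x - x') (y - y')" for x y x' y'
    by (auto simp: pair_def)
  have pair: "pair x y \<in> seq_space q" "seq_norm q (pair x y) = (\<bar>x\<bar> powr q + \<bar>y\<bar> powr q) powr (1 / q)" for x y
    using lp_space_two_terms[of abs "pair x y" q]
    by (auto simp: seq_space_def lp_space_def seq_norm_def pair_def)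
  have pair0: "seq_norm q (pair x 0) = \<bar>x\<bar>" for x using q by (simp add: pair powr_powr)
  have mixed: "x \<in> mixed_space p q" 
      "mixed_norm p q x = (seq_norm q (x 0) powr p + seq_norm q (x 1) powr p) powr (1 / p)"
    if "\<And>n. x n \<in> seq_space q" "\<And>n. 2 \<le> n \<Longrightarrow> seq_norm q (x n) = 0" for x
    using that lp_space_two_terms[of "seq_norm q" x p]
    by (auto simp: mixed_space_def mixed_norm_def lp_space_def)
  have odiff: "outer x y - outer x' y' = outer (x - x') (y - y')" for x y x' y'
    by (auto simp: outer_def pair_def fun_eq_iff)
  have idiff: "inner x y - inner x' y' = inner (x - x') (y - y')" for x y x' y'
    by (auto simp: inner_def pair_def fun_eq_iff)
  have outer: "outer x y \<in> mixed_space p q"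
      "mixed_norm p q (outer x y) = (\<bar>x\<bar> powr p + \<bar>y\<bar> powr p) powr (1 / p)" for x y
    using mixed[of "outer x y"] pair(1) by (auto simp: outer_def pair0 pair_def[of x y])
  have inner: "inner x y \<in> mixed_space p q"
      "mixed_norm p q (inner x y) = (\<bar>x\<bar> powr q + \<bar>y\<bar> powr q) powr (1 / q)" for x y
    using mixed[of "inner x y"] pair(1) p by (auto simp: inner_def pair(2) pair0 powr_powr)
  have "ereal r \<le> ereal p" "ereal r \<le> conj_exponent p"
    by (rule has_roundness_le_if_plane_embeds[OF R p, of outer], use outer odiff in \<open>simp_all add: mixed_dist_def\<close>)+
  moreover have "ereal r \<le> ereal q" "ereal r \<le> conj_exponent q"
    by (rule has_roundness_le_if_plane_embeds[OF R q, of inner], use inner idiff in \<open>simp_all add: mixed_dist_def\<close>)+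
  ultimately show ?thesis by simp
qed

lemma le_conj_exponent_iff:
  assumes "1 < r" "1 \<le> p"
  shows "ereal r \<le> conj_exponent p \<longleftrightarrow> p \<le> r / (r - 1)"
  using assms by (auto simp: conj_exponent_def field_simps)

theorem corollary3p7:
  fixes p q :: real
  assumes "1 \<le> p" and "1 \<le> q"
  shows "Metric_space.max_roundness (mixed_space p q) (mixed_dist p q)
           = Min {ereal p, conj_exponent p, ereal q, conj_exponent q}"
proof -
  interpret Metric_space "mixed_space p q" "mixed_dist p q"
    using assms by (rule mixed_Metric_space)
  define m where "m = Min {ereal p, conj_exponent p, ereal q, conj_exponent q}"
  have conj1: "1 \<le> conj_exponent t" if "1 \<le> t" for t
    using that by (auto simp: conj_exponent_def one_ereal_def)
  have "1 \<le> m" "m \<le> ereal p" using assms conj1 by (auto simp: m_def)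
  then obtain r where r: "m = ereal r" "1 \<le> r"
    by (cases m) (auto simp: one_ereal_def)
  have "ereal r \<le> ereal p" "ereal r \<le> ereal q"
    and conj: "ereal r \<le> conj_exponent p" "ereal r \<le> conj_exponent q"
    unfolding r(1)[symmetric] m_def by (simp_all add: min_le_iff_disj)
  then have le: "r \<le> p" "r \<le> q" by simp_all
  have "has_roundness r"
  proof (cases "r = 1")
    case True
    then show ?thesis using has_roundness_1 by simp
  next
    case False
    then have r1: "1 < r" using r by simp
    define s where "s = r / (r - 1)"
    have ps: "p \<le> s" "q \<le> s" using conj r1 assms by (auto simp: s_def le_conj_exponent_iff)
    have rs: "r \<le> s" using le(1) ps(1) by simp
    then have "r \<le> 2" using r1 by (auto simp: s_def field_simps)
    then have "clarkson_roundness r s (mixed_space p q) (mixed_dist p q)"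
      using r1 s_def le ps by (intro clarkson_roundness_mixed_space)
    then show ?thesis using has_roundness_if_clarkson_roundness r rs by blast
  qed
  moreover have "ereal t \<le> m" if "has_roundness t" for t
    using has_roundness_mixed_space_le[OF assms that] by (simp add: m_def)
  ultimately have "max_roundness = m"
    unfolding max_roundness_def by (intro antisym SUP_least SUP_upper2[of r]) (auto simp: r)
  then show ?thesis by (simp add: m_def)
qed

end
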